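(* Let $a,b,m\ge0$ be integers, and let $\ell\in\mathbb Z\setminus\{0\}$. (1) If $0<\ell<a-b$, then $$G_{a,b}^{\ge 2m+1,\ell}(q)=G_{a,b}^{\ge 2m,\ell}(q)=q^{m(2m+1+\ell)}\begin{bmatrix}a+b\\ a+2m\end{bmatrix}_q.$$ (2) If $0>\ell>a-b$, then $$G_{a,b}^{\ge 2m+1,\ell}(q)=G_{a,b}^{\ge 2m,\ell}(q)=q^{m(2m-1-\ell)}\begin{bmatrix}a+b\\ a-2m\end{bmatrix}_q.$$ (3) If $\ell<0$, $\ell<a-b$ and $m\ge1$, then $$G_{a,b}^{\ge 2m,\ell}(q)=G_{a,b}^{\ge 2m-1,\ell}(q)=q^{m(2m-1-\ell)}\begin{bmatrix}a+b\\ a+2m-1-\ell\end{bmatrix}_q.$$ (4) If $\ell>0$, $\ell>a-b$ and $m\ge1$, then $$G_{a,b}^{\ge 2m,\ell}(q)=G_{a,b}^{\ge 2m-1,\ell}(q)=q^{(m-1)(2m-1+\ell)}\begin{bmatrix}a+b\\ a-2m+1-\ell\end{bmatrix}_q.$$ (5) If $0<\ell=a-b$, then $$G_{a,b}^{\ge 2m,\ell}(q)=q^{m(2m+1+\ell)}\begin{bmatrix}a+b\\ a+2m\end{bmatrix}_q,\qquad G_{a,b}^{\ge 2m+1,\ell}(q)=q^{m(2m+1+\ell)}\begin{bmatrix}a+b\\ a+2m+1\end{bmatrix}_q.$$ (6) If $0>\ell=a-b$, then $$G_{a,b}^{\ge 2m,\ell}(q)=q^{m(2m-1-\ell)}\begin{bmatrix}a+b\\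 a-2m\end{bmatrix}_q,\qquad G_{a,b}^{\ge 2m+1,\ell}(q)=q^{(m+1)(2m+1-\ell)}\begin{bmatrix}a+b\\ a-2m-1\end{bmatrix}_q.$$
   Context: For integers $a,b\ge0$, $\mathcal G_{a,b}$ denotes the set of lattice paths in $\mathbb Z^2$ starting at the origin and consisting of $a$ steps $U=(1,1)$ and $b$ steps $D=(1,-1)$ (in any order). A valley of a path is a vertex preceded by a $D$ and followed by a $U$; the major index $\operatorname{maj}(P)$ is the sum of the $x$-coordinates of the valleys of $P$. For $\ell\in\mathbb Z$, a crossing of $P$ with the line $y=\ell$ is a vertex of $P$ on this line that is either preceded and followed by a $D$, or preceded and followed by a $U$. For $r\ge0$, $\mathcal G_{a,b}^{\ge r,\ell}$ is the set of paths in $\mathcal G_{a,b}$ that cross the line $y=\ell$ at least $r$ times, and $$G_{a,b}^{\ge r,\ell}(q)=\sum_{P\in\mathcal G_{a,b}^{\ge r,\ell}}q^{\operatorname{maj}(P)}.$$ For integers $n,k$, the $q$-binomial coefficient is $$\begin{bmatrix}n\\k\end{bmatrix}_q=\frac{(1-q^n)(1-q^{n-1})\cdots(1-q^{n-k+1})}{(1-q^k)(1-q^{k-1})\cdots(1-q)}$$ if $0\le k\le n$, and $0$ otherwise. *)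

theory Defs
  imports Main "HOL-Computational_Algebra.Polynomial_Factorial"
begin

datatype step = U | D

fun rise :: "step \<Rightarrow> int" where
  "rise U = 1"
| "rise D = - 1"

(* A lattice path from the origin is its list of steps. Every step advances x by 1, so the
   vertices are indexed by their x-coordinate: for 0 \<le> i \<le> length P, vertex i of P
   is the point (i, height P i). *)

definition height :: "step list \<Rightarrow> nat \<Rightarrow> int" where
  "height P i = (\<Sum>s\<leftarrow>take i P. rise s)"

definition paths :: "nat \<Rightarrow> nat \<Rightarrow> step list set" where
  "paths a b = {P. count_list P U = a \<and> count_list P D = b}"

(* Vertex i, 0 < i < length P, is preceded by the step P ! (i - 1) and followed by P ! i;
   the endpoints of a path are neither valleys nor crossings. *)

definition valleys :: "step list \<Rightarrow> nat set" where
  "valleys P = {i. 0 < i \<and> i < length P \<and> P ! (i - 1) = D \<and> P ! i = U}"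

definition maj :: "step list \<Rightarrow> nat" where
  "maj P = \<Sum>(valleys P)"

definition crossings :: "int \<Rightarrow> step list \<Rightarrow> nat set" where
  "crossings l P = {i. 0 < i \<and> i < length P \<and> height P i = l \<and>
     (P ! (i - 1) = D \<and> P ! i = D \<or> P ! (i - 1) = U \<and> P ! i = U)}"

definition paths_ge :: "nat \<Rightarrow> nat \<Rightarrow> nat \<Rightarrow> int \<Rightarrow> step list set" where
  "paths_ge a b r l = {P \<in> paths a b. r \<le> card (crossings l P)}"

(* paths_ge a b r l is finite, so the sum defining G_ge below is a genuine finite sum. *)

lemma length_eq_count_steps: "length P = count_list P U + count_list P D"
proof (induction P)
  case (Cons s P)
  then show ?case by (cases s) auto
qed simp

lemma finite_paths: "finite (paths a b)"
proof (rule finite_subset)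
  have "UNIV = {U, D}"
    using step.exhaust by auto
  then have "finite (UNIV :: step set)"
    by (metis finite.emptyI finite.insertI)
  then show "finite {P :: step list. set P \<subseteq> UNIV \<and> length P = a + b}"
    by (rule finite_lists_length_eq)
  show "paths a b \<subseteq> {P. set P \<subseteq> UNIV \<and> length P = a + b}"
    by (auto simp: paths_def length_eq_count_steps)
qed

lemma finite_paths_ge: "finite (paths_ge a b r l)"
  unfolding paths_ge_def using finite_paths by simp

(* The indeterminate q, in the field of fractions of the polynomial ring over the integers.
   That ring embeds in its fraction field, so identities between polynomials in q may be
   stated there, where the quotient defining the q-binomial coefficient is true division. *)

definition qvar :: "int poly fract" where
  "qvar = to_fract (monom 1 1)"

definition G_ge :: "nat \<Rightarrow> nat \<Rightarrow> nat \<Rightarrow> int \<Rightarrow> int poly fract" where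
  "G_ge a b r l = (\<Sum>P\<in>paths_ge a b r l. qvar ^ maj P)"

definition qbinomial :: "int \<Rightarrow> int \<Rightarrow> int poly fract" where
  "qbinomial n k =
     (if 0 \<le> k \<and> k \<le> n
      then (\<Prod>i\<in>{n - k + 1..n}. 1 - qvar powi i) / (\<Prod>i\<in>{1..k}. 1 - qvar powi i)
      else 0)"

end

theory Submission
  imports Defs
begin

text \<open>
  The proof builds paths one step at a time. Split the paths counted by \<^term>\<open>G_ge a b r l\<close>
  according to whether their last step is a \<^const>\<open>D\<close>. Deleting the last step then gives a
  recurrence for the two parts \<open>G_up\<close> and \<open>G_down\<close>
  (lemmas \<open>G_up_Suc\<close> and \<open>G_down_Suc\<close>): appending a \<^const>\<open>U\<close> to a path of length n that
  ends in \<^const>\<open>D\<close> creates a valley and costs $q^n$, and repeating the last step at a vertex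
  of the line $y = l$ creates a crossing.

  Away from the line the threshold r does not change, and the recurrence is the one that the
  polynomials counting all paths satisfy. It is linear, and its coefficients depend on a + b
  only. So a and b may be translated in opposite directions, and for every integer s it is solved by
  \[ q^{e(s)} \binom{a+b}{a+s}_q, \qquad e(s) = s(s+1+l)/2, \]
  together with its division into an up part and a down part. The exponents in all six cases
  are of this form, so the task is to find, for each r and each side of the line, the right
  shift s. (The product $s(s+1+l)$ is even for all the shifts that occur.)

  At the line solutions with different shifts have to be matched. For $a - b = l$ the down part is invariant under $s \mapsto -1-l-s$, and the up part is invariant
  under $s \mapsto 1-l-s$ (lemmas \<open>down_part_reflect\<close> and \<open>up_part_reflect\<close>); the exponent e(s)
  is the one for which both symmetries hold. A path that has just crossed upwards was below the
  line with one crossing fewer, so the shift for r above the line must be the reflection of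
  the shift for r - 1 below it, and dually for downward crossings. Starting from the shift 0 at
  r = 0 this determines all shifts by alternating the two reflections. The
  composition of the two is a translation by 2, which is why the answers depend on the
  parity of r. There is one exception: a path that ends on the other side of the line than the
  origin crosses it at least once, so the first crossing towards that side leaves the shift
  unchanged (lemmas \<open>shift_above_step\<close> and \<open>shift_below_step\<close>). An induction on the length
  of the path turns this into \<open>G_up_and_G_down\<close>, from which the six cases are read off.
\<close>

section \<open>Gaussian binomial coefficients\<close>

lemma qvar_nonzero: "qvar \<noteq> 0"
  by (simp add: qvar_def monom_eq_0_iff)

lemma qvar_power_neq_1:
  assumes "0 < n"
  shows "qvar ^ n \<noteq> 1"
proof
  have "to_fract (p ^ n) = to_fract p ^ n" for p :: "int poly"
    by (induction n) auto
  moreover assume "qvar ^ n = 1"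
  ultimately have "to_fract (monom 1 1 ^ n :: int poly) = to_fract 1"
    by (simp add: qvar_def)
  then have "(monom 1 1 ^ n :: int poly) = 1"
    by (simp only: to_fract_eq_iff)
  then have "degree (monom (1 :: int) n) = 0"
    by (simp add: monom_power)
  then show False
    using assms by (simp add: degree_monom_eq)
qed

text \<open>
  Up to the factor $(1-q)^k$ this is the q-factorial. It makes the symmetry of the coefficient
  visible and reduces identities to fractions with nonzero denominators.
\<close>

definition qfact :: "int \<Rightarrow> int poly fract" where
  "qfact k = (\<Prod>i\<in>{1..k}. 1 - qvar powi i)"

lemma qvar_powi_neq_1: "1 \<le> i \<Longrightarrow> qvar powi i \<noteq> 1"
  using qvar_power_neq_1[of "nat i"] by (simp add: power_int_def)

lemma qfact_nonzero: "qfact k \<noteq> 0"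
  unfolding qfact_def by (subst prod_zero_iff) (auto dest: qvar_powi_neq_1)

lemma qfact_rec: "1 \<le> k \<Longrightarrow> qfact k = (1 - qvar powi k) * qfact (k - 1)"
proof -
  assume "1 \<le> k"
  then have "{1..k} = insert k {1..k - 1}"
    by auto
  then show ?thesis
    unfolding qfact_def by simp
qed

lemma qbinomial_eq_qfact:
  assumes "0 \<le> k" "k \<le> n"
  shows "qbinomial n k = qfact n / (qfact k * qfact (n - k))"
proof -
  have "{1..n} = {1..n - k} \<union> {n - k + 1..n}"
    using assms by auto
  then have "qfact n = qfact (n - k) * (\<Prod>i\<in>{n - k + 1..n}. 1 - qvar powi i)"
    unfolding qfact_def by (simp add: prod.union_disjoint)
  then show ?thesis
    using assms qfact_nonzero[of "n - k"] by (simp add: qbinomial_def qfact_def)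
qed

lemma qbinomial_out_of_range: "k < 0 \<or> n < k \<Longrightarrow> qbinomial n k = 0"
  by (auto simp: qbinomial_def)

lemma qbinomial_0_right: "0 \<le> n \<Longrightarrow> qbinomial n 0 = 1"
  by (simp add: qbinomial_def)

lemma qbinomial_self: "0 \<le> n \<Longrightarrow> qbinomial n n = 1"
  using qfact_nonzero[of n] by (simp add: qbinomial_eq_qfact) (simp add: qfact_def)

lemma qbinomial_symmetric: "qbinomial n (n - k) = qbinomial n k"
proof (cases "0 \<le> k \<and> k \<le> n")
  case True
  then show ?thesis
    by (simp add: qbinomial_eq_qfact mult.commute)
qed (auto simp: qbinomial_def)

text \<open>
  Both identities below hold for all integers k, with the convention that the coefficient
  vanishes outside its range, so the
  recurrences for paths need no case distinction on the position of the lower index.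
\<close>

lemma qbinomial_absorb:
  assumes "0 \<le> n"
  shows "(1 - qvar powi (n - k)) * qbinomial n k = (1 - qvar powi n) * qbinomial (n - 1) k"
proof (cases "0 \<le> k \<and> k < n")
  case True
  then have "qbinomial n k =
      (1 - qvar powi n) * qfact (n - 1) / (qfact k * ((1 - qvar powi (n - k)) * qfact (n - k - 1)))"
    using qfact_rec[of n] qfact_rec[of "n - k"] by (simp add: qbinomial_eq_qfact)
  moreover have "qbinomial (n - 1) k = qfact (n - 1) / (qfact k * qfact (n - k - 1))"
    using True by (simp add: qbinomial_eq_qfact algebra_simps)
  moreover have "1 - qvar powi (n - k) \<noteq> 0"
    using qvar_powi_neq_1[of "n - k"] True by simp
  ultimately show ?thesis
    by simp
next
  case False
  then have "k = n \<or> k < 0 \<or> n < k"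
    by auto
  then show ?thesis
    by (auto simp: qbinomial_out_of_range)
qed

lemma qbinomial_pascal:
  assumes "1 \<le> n"
  shows "qbinomial n k = qbinomial (n - 1) k + qvar powi (n - k) * qbinomial (n - 1) (k - 1)"
proof (cases "0 < k \<and> k < n")
  case True
  \<comment> \<open>The numerator splits as $1 - xy = (1-y) + y(1-x)$ with $x = q^k$ and $y = q^{n-k}$.\<close>
  have combine: "(1 - x * y) * A / ((1 - x) * B * ((1 - y) * C)) =
      A / ((1 - x) * B * C) + y * (A / (B * ((1 - y) * C)))"
    if "1 - x \<noteq> 0" "1 - y \<noteq> 0" "B \<noteq> 0" "C \<noteq> 0" for x y A B C :: "int poly fract"
  proof -
    have "1 - x * y = (1 - y) + y * (1 - x)"
      by (simp add: algebra_simps)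
    then show ?thesis
      using that by (simp only:) (simp add: add_divide_distrib distrib_right)
  qed
  have reorder: "n - 1 - k = n - k - 1"
    by simp
  have "qvar powi n = qvar powi k * qvar powi (n - k)"
    using qvar_nonzero by (simp flip: power_int_add)
  then have "qbinomial n k = (1 - qvar powi k * qvar powi (n - k)) * qfact (n - 1) /
      ((1 - qvar powi k) * qfact (k - 1) * ((1 - qvar powi (n - k)) * qfact (n - k - 1)))"
    using True qfact_rec[of n] qfact_rec[of k] qfact_rec[of "n - k"]
    by (simp add: qbinomial_eq_qfact)
  moreover have "qbinomial (n - 1) k =
      qfact (n - 1) / ((1 - qvar powi k) * qfact (k - 1) * qfact (n - k - 1))"
    using True qfact_rec[of k] by (simp add: qbinomial_eq_qfact reorder)
  moreover have "qbinomial (n - 1) (k - 1) =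
      qfact (n - 1) / (qfact (k - 1) * ((1 - qvar powi (n - k)) * qfact (n - k - 1)))"
    using True qfact_rec[of "n - k"] by (simp add: qbinomial_eq_qfact)
  ultimately show ?thesis
    using combine[of "qvar powi k" "qvar powi (n - k)"] True qvar_powi_neq_1 qfact_nonzero by simp
next
  case False
  then have "k = 0 \<or> k = n \<or> k < 0 \<or> n < k"
    by auto
  then show ?thesis
    using assms by (auto simp: qbinomial_out_of_range qbinomial_0_right qbinomial_self)
qed

section \<open>Appending a step to a path\<close>

text \<open>
  The empty path counts as not ending in \<^const>\<open>D\<close>: appending a \<^const>\<open>U\<close> to it creates no
  valley, exactly as after a \<^const>\<open>U\<close>.
\<close>

definition ends_down :: "step list \<Rightarrow> bool" where
  "ends_down P \<longleftrightarrow> P \<noteq> [] \<and> last P = D"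

lemma finite_valleys: "finite (valleys P)" and finite_crossings: "finite (crossings l P)"
  unfolding valleys_def crossings_def by auto

lemma maj_snoc: "maj (P @ [x]) = maj P + (if ends_down P \<and> x = U then length P else 0)"
proof -
  have "valleys (P @ [x]) = valleys P \<union> (if ends_down P \<and> x = U then {length P} else {})"
    by (cases "P = []") (auto simp: valleys_def ends_down_def nth_append last_conv_nth less_Suc_eq)
  moreover have "length P \<notin> valleys P"
    by (simp add: valleys_def)
  ultimately show ?thesis
    using finite_valleys[of P] by (simp add: maj_def)
qed

lemma height_end: "P \<in> paths a b \<Longrightarrow> height P (length P) = int a - int b"
proof -
  have "height P (length P) = int (count_list P U) - int (count_list P D)"
    unfolding height_def
  proof (induction P)
    case (Cons s P)
    then show ?case
      by (cases s) auto
  qed simp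
  then show "P \<in> paths a b \<Longrightarrow> ?thesis"
    by (simp add: paths_def)
qed

lemma card_crossings_snoc:
  "card (crossings l (P @ [x])) = card (crossings l P) +
     (if P \<noteq> [] \<and> last P = x \<and> height P (length P) = l then 1 else 0)"
proof -
  have height: "height (P @ [x]) i = height P i" if "i \<le> length P" for i
    using that by (simp add: height_def)
  have "i \<in> crossings l (P @ [x]) \<longleftrightarrow>
      i \<in> crossings l P \<or> i = length P \<and> P \<noteq> [] \<and> last P = x \<and> height P (length P) = l" for i
  proof -
    consider "i < length P" | "i = length P" | "length P < i"
      by linarith
    then show ?thesis
    proof cases
      case 1
      then show ?thesis
        by (auto simp: crossings_def nth_append height)
    next
      case 2
      then show ?thesis
        using height[of "length P"]
        by (cases x; cases "P = []"; cases "last P")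
          (simp_all add: crossings_def nth_append last_conv_nth)
    next
      case 3
      then show ?thesis
        by (simp add: crossings_def)
    qed
  qed
  then have "crossings l (P @ [x]) = crossings l P \<union>
      (if P \<noteq> [] \<and> last P = x \<and> height P (length P) = l then {length P} else {})"
    by (intro set_eqI) auto
  moreover have "length P \<notin> crossings l P"
    by (simp add: crossings_def)
  ultimately show ?thesis
    using finite_crossings[of l P] by simp
qed

definition G_up :: "nat \<Rightarrow> nat \<Rightarrow> nat \<Rightarrow> int \<Rightarrow> int poly fract" where
  "G_up a b r l = (\<Sum>P\<in>{P \<in> paths_ge a b r l. \<not> ends_down P}. qvar ^ maj P)"

definition G_down :: "nat \<Rightarrow> nat \<Rightarrow> nat \<Rightarrow> int \<Rightarrow> int poly fract" where
  "G_down a b r l = (\<Sum>P\<in>{P \<in> paths_ge a b r l. ends_down P}. qvar ^ maj P)"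

lemma sum_split_last_step:
  assumes "finite A"
  shows "sum f A = sum f {P \<in> A. \<not> ends_down P} + sum f {P \<in> A. ends_down P}"
proof -
  have "A = {P \<in> A. \<not> ends_down P} \<union> {P \<in> A. ends_down P}"
    by auto
  then show ?thesis
    using assms by (metis (no_types, lifting) sum.union_disjoint finite_Un disjoint_iff mem_Collect_eq)
qed

lemma G_ge_split: "G_ge a b r l = G_up a b r l + G_down a b r l"
  unfolding G_ge_def G_up_def G_down_def by (rule sum_split_last_step) (rule finite_paths_ge)

lemma paths_0_0: "paths 0 0 = {[]}"
  by (auto simp: paths_def) (metis length_eq_count_steps add_0 length_0_conv)

lemma G_up_0_0: "G_up 0 0 r l = (if r = 0 then 1 else 0)"
proof -
  have "{P \<in> paths_ge 0 0 r l. \<not> ends_down P} = (if r = 0 then {[]} else {})"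
    by (auto simp: paths_ge_def paths_0_0 ends_down_def crossings_def)
  then show ?thesis
    by (simp add: G_up_def maj_def valleys_def)
qed

lemma G_up_0_left:
  assumes "0 < b"
  shows "G_up 0 b r l = 0"
proof -
  have "ends_down P" if "P \<in> paths 0 b" for P
  proof (cases P rule: rev_cases)
    case (snoc P' x)
    then show ?thesis
      using that by (cases x) (auto simp: paths_def ends_down_def)
  qed (use that assms in \<open>simp add: paths_def\<close>)
  then have "{P \<in> paths_ge 0 b r l. \<not> ends_down P} = {}"
    by (auto simp: paths_ge_def)
  then show ?thesis
    by (simp only: G_up_def sum.empty)
qed

lemma G_down_0_right: "G_down a 0 r l = 0"
proof -
  have "{P \<in> paths_ge a 0 r l. ends_down P} = {}"
    by (auto simp: paths_ge_def paths_def ends_down_def count_list_0_iff)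
       (metis last_in_set)
  then show ?thesis
    by (simp only: G_down_def sum.empty)
qed

text \<open>
  Every path with last step \<^const>\<open>U\<close> arises from exactly one shorter path. If that path
  does not end in \<^const>\<open>D\<close>, its end becomes a crossing when it lies on the line; if it ends in \<^const>\<open>D\<close>, its
  end becomes a valley instead, at x-coordinate a + b. For r = 0 the truncated
  difference r - 1 is 0, and both thresholds are void.
\<close>

lemma G_up_Suc:
  assumes "l \<noteq> 0"
  shows "G_up (Suc a) b r l =
    G_up a b (if int a - int b = l then r - 1 else r) l + qvar ^ (a + b) * G_down a b r l"
proof -
  let ?A = "{P \<in> paths a b. r \<le> card (crossings l (P @ [U]))}"
  have "P \<in> (\<lambda>P. P @ [U]) ` ?A" if "P \<in> paths_ge (Suc a) b r l" "\<not> ends_down P" for P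
  proof (cases P rule: rev_cases)
    case (snoc P' x)
    then have "x = U"
      using that by (cases x) (auto simp: ends_down_def)
    then show ?thesis
      using that snoc by (auto simp: paths_ge_def paths_def)
  qed (use that in \<open>simp add: paths_ge_def paths_def\<close>)
  then have "{P \<in> paths_ge (Suc a) b r l. \<not> ends_down P} = (\<lambda>P. P @ [U]) ` ?A"
    by (auto simp: paths_ge_def paths_def ends_down_def)
  then have "G_up (Suc a) b r l = (\<Sum>P\<in>?A. qvar ^ maj (P @ [U]))"
    unfolding G_up_def by (simp add: sum.reindex inj_on_def)
  also have "\<dots> = (\<Sum>P\<in>{P \<in> ?A. \<not> ends_down P}. qvar ^ maj (P @ [U])) +
      (\<Sum>P\<in>{P \<in> ?A. ends_down P}. qvar ^ maj (P @ [U]))"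
    by (rule sum_split_last_step) (simp add: finite_paths)
  also have "(\<Sum>P\<in>{P \<in> ?A. ends_down P}. qvar ^ maj (P @ [U])) = qvar ^ (a + b) * G_down a b r l"
    unfolding G_down_def sum_distrib_left
    by (rule sum.cong)
       (auto simp: paths_ge_def paths_def card_crossings_snoc ends_down_def maj_snoc
         length_eq_count_steps power_add)
  also have "(\<Sum>P\<in>{P \<in> ?A. \<not> ends_down P}. qvar ^ maj (P @ [U])) =
      G_up a b (if int a - int b = l then r - 1 else r) l"
  proof -
    \<comment> \<open>The origin is not on the line, so a path that ends there has a last step.\<close>
    have "r \<le> card (crossings l (P @ [U])) \<longleftrightarrow>
        (if int a - int b = l then r - 1 else r) \<le> card (crossings l P)"
      if "P \<in> paths a b" "\<not> ends_down P" for P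
    proof (cases "int a - int b = l")
      case True
      then have "P \<noteq> []"
        using that assms by (auto simp: paths_def)
      then have "last P = U"
        using that by (cases "last P") (auto simp: ends_down_def)
      then show ?thesis
        using True \<open>P \<noteq> []\<close> that by (auto simp: card_crossings_snoc height_end)
    qed (use that in \<open>simp add: card_crossings_snoc height_end\<close>)
    then have "{P \<in> ?A. \<not> ends_down P} =
        {P \<in> paths_ge a b (if int a - int b = l then r - 1 else r) l. \<not> ends_down P}"
      unfolding paths_ge_def by blast
    then show ?thesis
      unfolding G_up_def by (intro sum.cong) (auto simp: maj_snoc)
  qed
  finally show ?thesis .
qed

lemma G_down_Suc:
  "G_down a (Suc b) r l =
    G_up a b r l + G_down a b (if int a - int b = l then r - 1 else r) l"
proof -
  let ?A = "{P \<in> paths a b. r \<le> card (crossings l (P @ [D]))}"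
  have "P \<in> (\<lambda>P. P @ [D]) ` ?A" if "P \<in> paths_ge a (Suc b) r l" "ends_down P" for P
    using that by (cases P rule: rev_cases) (auto simp: paths_ge_def paths_def ends_down_def)
  then have "{P \<in> paths_ge a (Suc b) r l. ends_down P} = (\<lambda>P. P @ [D]) ` ?A"
    by (auto simp: paths_ge_def paths_def ends_down_def)
  then have "G_down a (Suc b) r l = (\<Sum>P\<in>?A. qvar ^ maj P)"
    unfolding G_down_def by (simp add: sum.reindex inj_on_def maj_snoc)
  also have "\<dots> = (\<Sum>P\<in>{P \<in> ?A. \<not> ends_down P}. qvar ^ maj P) +
      (\<Sum>P\<in>{P \<in> ?A. ends_down P}. qvar ^ maj P)"
    by (rule sum_split_last_step) (simp add: finite_paths)
  also have "{P \<in> ?A. \<not> ends_down P} = {P \<in> paths_ge a b r l. \<not> ends_down P}"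
    by (auto simp: paths_ge_def card_crossings_snoc ends_down_def)
  also have "{P \<in> ?A. ends_down P} =
      {P \<in> paths_ge a b (if int a - int b = l then r - 1 else r) l. ends_down P}"
    by (auto simp: paths_ge_def card_crossings_snoc ends_down_def height_end split: if_splits)
  finally show ?thesis
    by (simp add: G_up_def G_down_def)
qed

section \<open>Shifted solutions of the recurrence and their reflections\<close>

text \<open>
  The recurrence admits any scalar in front of the translated solution. The
  choice $e(s) = s(s+1+l)/2$ makes both reflections exact: e(s) is symmetric under
  $s \mapsto -1-l-s$, and $e(s) - s$ is symmetric under $s \mapsto 1-l-s$.
\<close>

definition shift_weight :: "int \<Rightarrow> int \<Rightarrow> int poly fract" where
  "shift_weight l s = qvar powi (s * (s + 1 + l) div 2)"

definition full_part :: "int \<Rightarrow> int \<Rightarrow> nat \<Rightarrow> nat \<Rightarrow> int poly fract" where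
  "full_part l s a b = shift_weight l s * qbinomial (int a + int b) (int a + s)"

text \<open>
  The down part is the full expression for b - 1, as removing a final \<^const>\<open>D\<close> does not
  change the major index.
\<close>

definition down_part :: "int \<Rightarrow> int \<Rightarrow> nat \<Rightarrow> nat \<Rightarrow> int poly fract" where
  "down_part l s a b = shift_weight l s * qbinomial (int a + int b - 1) (int a + s)"

definition up_part :: "int \<Rightarrow> int \<Rightarrow> nat \<Rightarrow> nat \<Rightarrow> int poly fract" where
  "up_part l s a b = full_part l s a b - down_part l s a b"

lemma down_part_Suc: "down_part l s a (Suc b) = up_part l s a b + down_part l s a b"
  by (simp add: up_part_def down_part_def full_part_def)

lemma up_part_eq:
  assumes "0 < a + b"
  shows "up_part l s a b =
    shift_weight l s * qvar powi (int b - s) * qbinomial (int a + int b - 1) (int a + s - 1)"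
proof -
  have "qbinomial (int a + int b) (int a + s) = qbinomial (int a + int b - 1) (int a + s) +
      qvar powi (int b - s) * qbinomial (int a + int b - 1) (int a + s - 1)"
    using qbinomial_pascal[of "int a + int b" "int a + s"] assms by simp
  then show ?thesis
    unfolding up_part_def full_part_def down_part_def
    by (simp only: distrib_left mult.assoc add_diff_cancel_left')
qed

text \<open>
  The up part for a + 1 is $q^{e(s)} q^{n-k}$ times the coefficient with parameters n = a + b and
  k = a + s. By absorption, replacing $q^{n-k}$ by 1 changes this by the multiple
  $1 - q^n$ of the down part.
\<close>

lemma up_part_Suc:
  "up_part l s (Suc a) b = up_part l s a b + qvar ^ (a + b) * down_part l s a b"
proof -
  let ?n = "int a + int b" and ?k = "int a + s"
  have "up_part l s (Suc a) b = shift_weight l s * (qvar powi (?n - ?k) * qbinomial ?n ?k)"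
    by (simp add: up_part_eq algebra_simps)
  also have "qvar powi (?n - ?k) * qbinomial ?n ?k =
      qbinomial ?n ?k - (1 - qvar powi (?n - ?k)) * qbinomial ?n ?k"
    by (simp add: algebra_simps)
  also have "\<dots> = qbinomial ?n ?k - (1 - qvar powi ?n) * qbinomial (?n - 1) ?k"
    by (subst qbinomial_absorb) auto
  also have "qvar powi ?n = qvar ^ (a + b)"
    by (simp flip: of_nat_add)
  finally show ?thesis
    by (simp add: up_part_def full_part_def down_part_def algebra_simps)
qed

lemma up_part_0_0: "up_part l s 0 0 = (if s = 0 then 1 else 0)"
proof (cases "s = 0")
  case True
  then show ?thesis
    by (simp add: up_part_def full_part_def down_part_def shift_weight_def qbinomial_def)
next
  case False
  then have "qbinomial 0 s = 0" "qbinomial (- 1) s = 0"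
    by (auto simp: qbinomial_def)
  then show ?thesis
    using False by (simp add: up_part_def full_part_def down_part_def)
qed

lemma up_part_0_left:
  assumes "0 < b" "s \<le> 0 \<or> int b < s"
  shows "up_part l s 0 b = 0"
proof -
  have "qbinomial (int b - 1) (s - 1) = 0"
    using assms by (intro qbinomial_out_of_range) linarith
  then show ?thesis
    using assms by (simp add: up_part_eq)
qed

lemma down_part_0_right:
  assumes "0 \<le> s \<or> s < - int a"
  shows "down_part l s a 0 = 0"
proof -
  have "qbinomial (int a - 1) (int a + s) = 0"
    using assms by (intro qbinomial_out_of_range) linarith
  then show ?thesis
    by (simp add: down_part_def)
qed

text \<open>
  When $a - b = l$, complementation k to n - 1 - k of the lower index of the coefficients with upper
  index n - 1 = a + b - 1 is a reflection of s, about a different centre for each part.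
\<close>

lemma down_part_reflect:
  assumes "int a - int b = l"
  shows "down_part l (- 1 - l - s) a b = down_part l s a b"
proof -
  have "(- 1 - l - s) * ((- 1 - l - s) + 1 + l) = s * (s + 1 + l)"
    by (simp add: algebra_simps)
  moreover have "int a + (- 1 - l - s) = int a + int b - 1 - (int a + s)"
    using assms by simp
  ultimately show ?thesis
    unfolding down_part_def shift_weight_def by (simp only: qbinomial_symmetric)
qed

lemma up_part_reflect:
  assumes "int a - int b = l" "l \<noteq> 0"
  shows "up_part l (1 - l - s) a b = up_part l s a b"
proof -
  have "(1 - l - s) * ((1 - l - s) + 1 + l) = s * (s + 1 + l) + (1 - l - 2 * s) * 2"
    by (simp add: algebra_simps)
  then have "(1 - l - s) * ((1 - l - s) + 1 + l) div 2 = s * (s + 1 + l) div 2 + (1 - l - 2 * s)"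
    by simp
  then have "shift_weight l (1 - l - s) * qvar powi (int b - (1 - l - s)) = shift_weight l s * qvar powi (int b - s)"
    using qvar_nonzero unfolding shift_weight_def by (simp flip: power_int_add)
  moreover have "int a + (1 - l - s) - 1 = int a + int b - 1 - (int a + s - 1)"
    using assms by simp
  moreover have "0 < a + b"
    using assms by auto
  ultimately show ?thesis
    by (simp only: up_part_eq qbinomial_symmetric)
qed

text \<open>
  For l > 0 a path ending above the line has crossed it an odd number of times, so r = 2m and
  r = 2m + 1 give the same shift there; below the line the shifts for 2m + 1 and 2m + 2 agree.
  For l < 0 the two sides exchange roles.
\<close>

definition shift_above :: "int \<Rightarrow> nat \<Rightarrow> int" where
  "shift_above l r =
     (if 0 < l then 2 * int (r div 2) else if r = 0 then 0 else 2 * int ((r + 1) div 2) - 1 - l)"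

definition shift_below :: "int \<Rightarrow> nat \<Rightarrow> int" where
  "shift_below l r =
     (if l < 0 then - 2 * int (r div 2) else if r = 0 then 0 else - 2 * int ((r - 1) div 2) - 1 - l)"

lemma shift_above_even: "0 < l \<Longrightarrow> shift_above l (2 * m) = 2 * int m"
  and shift_above_odd: "0 < l \<Longrightarrow> shift_above l (2 * m + 1) = 2 * int m"
  and shift_below_even: "l < 0 \<Longrightarrow> shift_below l (2 * m) = - 2 * int m"
  and shift_below_odd: "l < 0 \<Longrightarrow> shift_below l (2 * m + 1) = - 2 * int m"
  by (simp_all add: shift_above_def shift_below_def)

lemma shift_above_neg:
  assumes "l < 0" "1 \<le> m"
  shows "shift_above l (2 * m) = 2 * int m - 1 - l" "shift_above l (2 * m - 1) = 2 * int m - 1 - l"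
proof -
  have "(2 * m + 1) div 2 = m" "2 * m - 1 + 1 = 2 * m" "2 * m - 1 \<noteq> 0"
    using assms by auto
  then show "shift_above l (2 * m) = 2 * int m - 1 - l"
    "shift_above l (2 * m - 1) = 2 * int m - 1 - l"
    using assms unfolding shift_above_def by (auto simp del: One_nat_def)
qed

lemma shift_below_pos:
  assumes "0 < l" "1 \<le> m"
  shows "shift_below l (2 * m) = - 2 * int m + 1 - l" "shift_below l (2 * m - 1) = - 2 * int m + 1 - l"
proof -
  obtain j where "m = Suc j"
    using assms by (cases m) auto
  then show "shift_below l (2 * m) = - 2 * int m + 1 - l"
    "shift_below l (2 * m - 1) = - 2 * int m + 1 - l"
    using assms by (auto simp: shift_below_def)
qed

lemma shift_0: "shift_above l 0 = 0" "shift_below l 0 = 0"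
  by (simp_all add: shift_above_def shift_below_def)

text \<open>
  The shift stays the same for r = 0, where no crossing is used up, and for r = 1 on the side of
  the line opposite to the origin, where the first crossing is forced. Otherwise it is reflected.
\<close>

lemma shift_above_step:
  assumes "l \<noteq> 0"
  shows "shift_above l r = shift_below l (r - 1) \<or> shift_above l r = 1 - l - shift_below l (r - 1)"
proof -
  consider "r = 0" | "r = 1" | j where "r = 2 * j + 2" | j where "r = 2 * j + 3"
    by atomize_elim presburger
  then show ?thesis
    using assms by cases (auto simp: shift_above_def shift_below_def)
qed

lemma shift_below_step:
  assumes "l \<noteq> 0"
  shows "shift_below l r = shift_above l (r - 1) \<or> shift_below l r = - 1 - l - shift_above l (r - 1)"
proof -
  consider "r = 0" | "r = 1" | j where "r = 2 * j + 2" | j where "r = 2 * j + 3"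
    by atomize_elim presburger
  then show ?thesis
    using assms by cases (auto simp: shift_above_def shift_below_def)
qed

text \<open>
  The bounds provide the initial values of the recurrence: the up part vanishes for
  a = 0 < b and the down part for b = 0, and for the empty path the threshold r must be 0.
\<close>

lemma shift_above_bound: "0 \<le> shift_above l r" "l < 0 \<Longrightarrow> r \<noteq> 0 \<Longrightarrow> - l < shift_above l r"
proof -
  have "1 \<le> int ((r + 1) div 2)" if "r \<noteq> 0"
    using that by presburger
  then show "0 \<le> shift_above l r" "l < 0 \<Longrightarrow> r \<noteq> 0 \<Longrightarrow> - l < shift_above l r"
    unfolding shift_above_def by auto
qed

lemma shift_below_bound: "shift_below l r \<le> 0" "0 < l \<Longrightarrow> r \<noteq> 0 \<Longrightarrow> shift_below l r < - l"
  unfolding shift_below_def by auto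

lemma up_part_on_line:
  assumes "int a - int b = l" "l \<noteq> 0"
  shows "up_part l (shift_above l r) a b = up_part l (shift_below l (r - 1)) a b"
  using shift_above_step[OF assms(2), of r]
proof
  assume "shift_above l r = 1 - l - shift_below l (r - 1)"
  then show ?thesis
    using up_part_reflect[OF assms, of "shift_below l (r - 1)"] by (rule ssubst)
qed (erule arg_cong[where f = "\<lambda>s. up_part l s a b"])

lemma down_part_on_line:
  assumes "int a - int b = l" "l \<noteq> 0"
  shows "down_part l (shift_below l r) a b = down_part l (shift_above l (r - 1)) a b"
  using shift_below_step[OF assms(2), of r]
proof
  assume "shift_below l r = - 1 - l - shift_above l (r - 1)"
  then show ?thesis
    using down_part_reflect[OF assms(1), of "shift_above l (r - 1)"] by (rule ssubst)
qed (erule arg_cong[where f = "\<lambda>s. down_part l s a b"])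

section \<open>Counting paths by their last step\<close>

text \<open>
  A path ending on the line with a \<^const>\<open>U\<close> comes from below, and one ending there with a
  \<^const>\<open>D\<close> comes from above, and its last vertex is not yet a crossing. On the line the up part
  therefore carries the shift from below and the down part the shift from above, which is why one
  inequality is strict and the other is not. When the path leaves the line, one of its two
  parts has the right shift already, and the other is corrected by a reflection.
\<close>

lemma G_up_and_G_down:
  assumes "l \<noteq> 0"
  shows "G_up a b r l =
      up_part l (if int a - int b > l then shift_above l r else shift_below l r) a b \<and>
    G_down a b r l =
      down_part l (if int a - int b \<ge> l then shift_above l r else shift_below l r) a b"
proof (induction "a + b" arbitrary: a b r rule: less_induct)
  case less
  have up: "G_up a b r l =
    up_part l (if int a - int b > l then shift_above l r else shift_below l r) a b"
  proof (cases a)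
    case 0
    show ?thesis
    proof (cases b)
      case 0
      then show ?thesis
        using \<open>a = 0\<close> assms shift_above_bound(2)[of l r] shift_below_bound(2)[of l r]
        by (cases "r = 0") (auto simp: G_up_0_0 up_part_0_0 shift_0)
    next
      case (Suc b')
      have "shift_below l r \<le> 0" "- int b > l \<Longrightarrow> shift_above l r \<le> 0 \<or> int b < shift_above l r"
        using shift_above_bound(2)[of l r] shift_below_bound(1)[of l r] shift_0(1)[of l]
        by (cases "r = 0"; force)+
      then show ?thesis
        using \<open>a = 0\<close> Suc by (simp add: G_up_0_left up_part_0_left)
    qed
  next
    case (Suc a')
    consider "int a' - int b = l" | "int a' - int b < l" | "int a' - int b > l"
      by linarith
    then show ?thesis
      using less[of a' b] Suc assms up_part_on_line[of a' b l r]
      by cases (simp_all add: G_up_Suc up_part_Suc)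
  qed
  have down: "G_down a b r l =
    down_part l (if int a - int b \<ge> l then shift_above l r else shift_below l r) a b"
  proof (cases b)
    case 0
    have "0 \<le> shift_above l r" "int a < l \<Longrightarrow> 0 \<le> shift_below l r \<or> shift_below l r < - int a"
      using shift_above_bound(1)[of l r] shift_below_bound(2)[of l r] shift_0(2)[of l]
      by (cases "r = 0"; force)+
    then show ?thesis
      using 0 by (simp add: G_down_0_right down_part_0_right)
  next
    case (Suc b')
    consider "int a - int b' = l" | "int a - int b' < l" | "int a - int b' > l"
      by linarith
    then show ?thesis
      using less[of a b'] Suc assms down_part_on_line[of a b' l r]
      by cases (simp_all add: G_down_Suc down_part_Suc)
  qed
  show ?case
    using up down by blast
qed

lemma G_ge_above:
  assumes "l \<noteq> 0" "l < int a - int b"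
  shows "G_ge a b r l = full_part l (shift_above l r) a b"
  using assms G_up_and_G_down[OF assms(1), of a b r] by (simp add: G_ge_split up_part_def)

lemma G_ge_below:
  assumes "l \<noteq> 0" "int a - int b < l"
  shows "G_ge a b r l = full_part l (shift_below l r) a b"
  using assms G_up_and_G_down[OF assms(1), of a b r] by (simp add: G_ge_split up_part_def)

text \<open>
  On the line the up part and the down part have different shifts. If the shift of one side is the
  same for r and r + 1, then reflection brings the other part to that shift as well, and the sum
  is a single coefficient.
\<close>

lemma G_ge_on_line:
  assumes "l \<noteq> 0" "int a - int b = l"
  shows "shift_above l (r + 1) = shift_above l r \<Longrightarrow> G_ge a b r l = full_part l (shift_above l r) a b"
    and "shift_below l (r + 1) = shift_below l r \<Longrightarrow> G_ge a b r l = full_part l (shift_below l r) a b"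
proof -
  have split: "G_ge a b r l = up_part l (shift_below l r) a b + down_part l (shift_above l r) a b"
    using assms by (simp add: G_ge_split G_up_and_G_down)
  show "G_ge a b r l = full_part l (shift_above l r) a b"
    if "shift_above l (r + 1) = shift_above l r"
    using that split up_part_on_line[OF assms(2,1), of "r + 1"] by (simp add: up_part_def)
  show "G_ge a b r l = full_part l (shift_below l r) a b"
    if "shift_below l (r + 1) = shift_below l r"
    using that split down_part_on_line[OF assms(2,1), of "r + 1"] by (simp add: up_part_def)
qed

text \<open>The two forms of k are the two names of a coefficient under its symmetry.\<close>

lemma full_part_eq:
  assumes "s * (s + 1 + l) = 2 * e" "k = int a + s \<or> k = int b - s"
  shows "full_part l s a b = qvar powi e * qbinomial (int a + int b) k"
proof -
  have "qbinomial (int a + int b) k = qbinomial (int a + int b) (int a + s)"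
    using assms(2) qbinomial_symmetric[of "int a + int b" "int a + s"] by auto
  then show ?thesis
    using assms(1) by (simp add: full_part_def shift_weight_def)
qed

text \<open>
  Three closed forms carry all six cases: what remains is to evaluate them at the shifts for even
  and odd r. The command below displays the facts from which they are derived.
\<close>

thm_deps G_ge_above G_ge_below G_ge_on_line

theorem theorem2p2:
  fixes a b m :: nat and l :: int
  assumes "l \<noteq> 0"
  shows
    "(0 < l \<and> l < int a - int b \<longrightarrow>
        G_ge a b (2 * m + 1) l = G_ge a b (2 * m) l \<and>
        G_ge a b (2 * m) l
          = qvar powi (int m * (2 * int m + 1 + l)) * qbinomial (int a + int b) (int a + 2 * int m)) \<and>
     (0 > l \<and> l > int a - int b \<longrightarrow>
        G_ge a b (2 * m + 1) l = G_ge a b (2 * m) l \<and>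
        G_ge a b (2 * m) l
          = qvar powi (int m * (2 * int m - 1 - l)) * qbinomial (int a + int b) (int a - 2 * int m)) \<and>
     (l < 0 \<and> l < int a - int b \<and> m \<ge> 1 \<longrightarrow>
        G_ge a b (2 * m) l = G_ge a b (2 * m - 1) l \<and>
        G_ge a b (2 * m - 1) l
          = qvar powi (int m * (2 * int m - 1 - l)) * qbinomial (int a + int b) (int a + 2 * int m - 1 - l)) \<and>
     (l > 0 \<and> l > int a - int b \<and> m \<ge> 1 \<longrightarrow>
        G_ge a b (2 * m) l = G_ge a b (2 * m - 1) l \<and>
        G_ge a b (2 * m - 1) l
          = qvar powi ((int m - 1) * (2 * int m - 1 + l)) * qbinomial (int a + int b) (int a - 2 * int m + 1 - l)) \<and>
     (0 < l \<and> l = int a - int b \<longrightarrow>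
        G_ge a b (2 * m) l
          = qvar powi (int m * (2 * int m + 1 + l)) * qbinomial (int a + int b) (int a + 2 * int m) \<and>
        G_ge a b (2 * m + 1) l
          = qvar powi (int m * (2 * int m + 1 + l)) * qbinomial (int a + int b) (int a + 2 * int m + 1)) \<and>
     (0 > l \<and> l = int a - int b \<longrightarrow>
        G_ge a b (2 * m) l
          = qvar powi (int m * (2 * int m - 1 - l)) * qbinomial (int a + int b) (int a - 2 * int m) \<and>
        G_ge a b (2 * m + 1) l
          = qvar powi ((int m + 1) * (2 * int m + 1 - l)) * qbinomial (int a + int b) (int a - 2 * int m - 1))"
proof (intro conjI impI; elim conjE)
  assume l: "0 < l" "l < int a - int b"
  show "G_ge a b (2 * m + 1) l = G_ge a b (2 * m) l"
    by (simp only: G_ge_above[OF assms l(2)] shift_above_even[OF l(1)] shift_above_odd[OF l(1)])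
  show "G_ge a b (2 * m) l
      = qvar powi (int m * (2 * int m + 1 + l)) * qbinomial (int a + int b) (int a + 2 * int m)"
    unfolding G_ge_above[OF assms l(2)] shift_above_even[OF l(1)]
    by (rule full_part_eq) (simp_all add: algebra_simps)
next
  assume l: "0 > l" "l > int a - int b"
  show "G_ge a b (2 * m + 1) l = G_ge a b (2 * m) l"
    by (simp only: G_ge_below[OF assms l(2)] shift_below_even[OF l(1)] shift_below_odd[OF l(1)])
  show "G_ge a b (2 * m) l
      = qvar powi (int m * (2 * int m - 1 - l)) * qbinomial (int a + int b) (int a - 2 * int m)"
    unfolding G_ge_below[OF assms l(2)] shift_below_even[OF l(1)]
    by (rule full_part_eq) (simp_all add: algebra_simps)
next
  assume l: "l < 0" "l < int a - int b" and m: "m \<ge> 1"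
  show "G_ge a b (2 * m) l = G_ge a b (2 * m - 1) l"
    by (simp only: G_ge_above[OF assms l(2)] shift_above_neg[OF l(1) m])
  show "G_ge a b (2 * m - 1) l
      = qvar powi (int m * (2 * int m - 1 - l)) * qbinomial (int a + int b) (int a + 2 * int m - 1 - l)"
    unfolding G_ge_above[OF assms l(2)] shift_above_neg[OF l(1) m]
    by (rule full_part_eq) (simp_all add: algebra_simps)
next
  assume l: "l > 0" "l > int a - int b" and m: "m \<ge> 1"
  show "G_ge a b (2 * m) l = G_ge a b (2 * m - 1) l"
    by (simp only: G_ge_below[OF assms l(2)] shift_below_pos[OF l(1) m])
  show "G_ge a b (2 * m - 1) l
      = qvar powi ((int m - 1) * (2 * int m - 1 + l)) * qbinomial (int a + int b) (int a - 2 * int m + 1 - l)"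
    unfolding G_ge_below[OF assms l(2)] shift_below_pos[OF l(1) m]
    by (rule full_part_eq) (simp_all add: algebra_simps)
next
  assume l: "0 < l" "l = int a - int b"
  have "G_ge a b (2 * m) l = full_part l (2 * int m) a b"
    using G_ge_on_line(1)[OF assms l(2)[symmetric], of "2 * m"]
    by (simp only: shift_above_even[OF l(1)] shift_above_odd[OF l(1)])
  also have "\<dots> = qvar powi (int m * (2 * int m + 1 + l)) * qbinomial (int a + int b) (int a + 2 * int m)"
    by (rule full_part_eq) (simp_all add: algebra_simps)
  finally show "G_ge a b (2 * m) l
      = qvar powi (int m * (2 * int m + 1 + l)) * qbinomial (int a + int b) (int a + 2 * int m)" .
  have "G_ge a b (2 * m + 1) l = full_part l (- 2 * int (m + 1) + 1 - l) a b"
    using G_ge_on_line(2)[OF assms l(2)[symmetric], of "2 * m + 1"] shift_below_pos[OF l(1), of "m + 1"]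
    by simp
  also have "\<dots> = qvar powi (int m * (2 * int m + 1 + l)) * qbinomial (int a + int b) (int a + 2 * int m + 1)"
    by (rule full_part_eq) (simp_all add: algebra_simps l(2))
  finally show "G_ge a b (2 * m + 1) l
      = qvar powi (int m * (2 * int m + 1 + l)) * qbinomial (int a + int b) (int a + 2 * int m + 1)" .
next
  assume l: "0 > l" "l = int a - int b"
  have "G_ge a b (2 * m) l = full_part l (- 2 * int m) a b"
    using G_ge_on_line(2)[OF assms l(2)[symmetric], of "2 * m"]
    by (simp only: shift_below_even[OF l(1)] shift_below_odd[OF l(1)])
  also have "\<dots> = qvar powi (int m * (2 * int m - 1 - l)) * qbinomial (int a + int b) (int a - 2 * int m)"
    by (rule full_part_eq) (simp_all add: algebra_simps)
  finally show "G_ge a b (2 * m) l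
      = qvar powi (int m * (2 * int m - 1 - l)) * qbinomial (int a + int b) (int a - 2 * int m)" .
  have "G_ge a b (2 * m + 1) l = full_part l (2 * int (m + 1) - 1 - l) a b"
    using G_ge_on_line(1)[OF assms l(2)[symmetric], of "2 * m + 1"] shift_above_neg[OF l(1), of "m + 1"]
    by simp
  also have "\<dots> = qvar powi ((int m + 1) * (2 * int m + 1 - l)) * qbinomial (int a + int b) (int a - 2 * int m - 1)"
    by (rule full_part_eq) (simp_all add: algebra_simps l(2))
  finally show "G_ge a b (2 * m + 1) l
      = qvar powi ((int m + 1) * (2 * int m + 1 - l)) * qbinomial (int a + int b) (int a - 2 * int m - 1)" .
qed

end
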